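(* Let $\Gamma$ be a reduct of $\mathbb{P}$ in which $<$ and $\bot$ are primitive positive definable. Let $f\in{\rm Pol}(\Gamma)$ be a binary polymorphism which is canonical as a function from $(P;\leq,\prec)^2$ to $(P;\leq)$. Then at least one of the following holds: $f$ is dominated; ${\rm Pol}(\Gamma)$ contains $e_<$; ${\rm Pol}(\Gamma)$ contains $e_\leq$.
   Context: $\mathbb{P}=(P;\leq)$ is the random partial order (Fraïssé limit of all finite partial orders); $x<y$ means $x\leq y\wedge x\ne y$, $x\bot y$ means $x,y$ incomparable. A reduct of $\mathbb{P}$ is a structure on $P$ with relations first-order definable in $\mathbb{P}$; primitive positive definable means definable by $\exists\bar y$ (conjunction of atomic formulas). ${\rm Pol}(\Gamma)$ is the set of all finitary operations on $P$ preserving all relations of $\Gamma$ (componentwise). $(P;\leq,\prec)$ denotes the Fraïssé limit of the class of finite structures $(A;\leq,\prec)$ where $\leq$ is a partial order and $\prec$ a linear order extending $<$; its $\leq$-reduct is identified with $\mathbb{P}$. A binary $f:P^2\to P$ is canonical from $(P;\leq,\prec)^2$ to $(P;\leq)$ if for every $s\geq1$, all $\alpha_1,\alpha_2\in{\rm Aut}(P;\leq,\prec)$ and all $d_1,d_2\in P^s$ there is $\beta\in{\rm Aut}(P;\leq)$ with $f(\alpha_1(d_1),\alpha_2(d_2))=\beta(f(d_1,d_2))$ (all maps applied componentwise). $f$ is dominated on the first argument if $f(x,y)<f(x',y')$ whenever $x<x'$ and $f(x,y)\bot f(x',y')$ whenever $x\bot x'$ (for all $y,y'$); $f$ is dominated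 if $f$ or $(x,y)\mapsto f(y,x)$ is dominated on the first argument. $e_<:P^2\to P$ is a fixed embedding of $(P;<)^2$ into $(P;<)$, i.e. an injective map with $e_<(a,b)<e_<(a',b')\iff(a<a'\wedge b<b')$; $e_\leq:P^2\to P$ is a fixed embedding of $(P;\leq)^2$ into $(P;\leq)$, i.e. injective with $e_\leq(a,b)\leq e_\leq(a',b')\iff(a\leq a'\wedge b\leq b')$. *)

theory Defs
  imports Main "HOL-Library.Countable_Set"
begin

definition po_lin_on :: "'b set \<Rightarrow> ('b \<Rightarrow> 'b \<Rightarrow> bool) \<Rightarrow> ('b \<Rightarrow> 'b \<Rightarrow> bool) \<Rightarrow> bool" where
  "po_lin_on A le pr \<longleftrightarrow>
     (\<forall>x\<in>A. le x x) \<and>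
     (\<forall>x\<in>A. \<forall>y\<in>A. le x y \<and> le y x \<longrightarrow> x = y) \<and>
     (\<forall>x\<in>A. \<forall>y\<in>A. \<forall>z\<in>A. le x y \<and> le y z \<longrightarrow> le x z) \<and>
     (\<forall>x\<in>A. \<not> pr x x) \<and>
     (\<forall>x\<in>A. \<forall>y\<in>A. \<forall>z\<in>A. pr x y \<and> pr y z \<longrightarrow> pr x z) \<and>
     (\<forall>x\<in>A. \<forall>y\<in>A. x \<noteq> y \<longrightarrow> pr x y \<or> pr y x) \<and>
     (\<forall>x\<in>A. \<forall>y\<in>A. le x y \<and> x \<noteq> y \<longrightarrow> pr x y)"

definition aut2 :: "('a \<Rightarrow> 'a \<Rightarrow> bool) \<Rightarrow> ('a \<Rightarrow> 'a \<Rightarrow> bool) \<Rightarrow> ('a \<Rightarrow> 'a) \<Rightarrow> bool" where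
  "aut2 le pr \<alpha> \<longleftrightarrow> bij \<alpha> \<and> (\<forall>x y. le x y \<longleftrightarrow> le (\<alpha> x) (\<alpha> y)) \<and> (\<forall>x y. pr x y \<longleftrightarrow> pr (\<alpha> x) (\<alpha> y))"

definition aut1 :: "('a \<Rightarrow> 'a \<Rightarrow> bool) \<Rightarrow> ('a \<Rightarrow> 'a) \<Rightarrow> bool" where
  "aut1 le \<beta> \<longleftrightarrow> bij \<beta> \<and> (\<forall>x y. le x y \<longleftrightarrow> le (\<beta> x) (\<beta> y))"

text \<open>(UNIV::'a set; le, pr) is the Fraisse limit of K: it is countable, its age is K
  (every finite substructure lies in K, and every member of K, up to isomorphism a
  structure on some {..<n}, embeds into it), and it is ultrahomogeneous.\<close>
definition fraisse_limit_K :: "('a \<Rightarrow> 'a \<Rightarrow> bool) \<Rightarrow> ('a \<Rightarrow> 'a \<Rightarrow> bool) \<Rightarrow> bool" where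
  "fraisse_limit_K le pr \<longleftrightarrow>
     countable (UNIV :: 'a set) \<and>
     (\<forall>A :: 'a set. finite A \<longrightarrow> po_lin_on A le pr) \<and>
     (\<forall>(n::nat) le' pr'. po_lin_on {..<n} le' pr' \<longrightarrow>
        (\<exists>e :: nat \<Rightarrow> 'a. inj_on e {..<n} \<and>
           (\<forall>x\<in>{..<n}. \<forall>y\<in>{..<n}. (le' x y \<longleftrightarrow> le (e x) (e y)) \<and> (pr' x y \<longleftrightarrow> pr (e x) (e y))))) \<and>
     (\<forall>(A :: 'a set) B h. finite A \<and> bij_betw h A B \<and>
        (\<forall>x\<in>A. \<forall>y\<in>A. (le x y \<longleftrightarrow> le (h x) (h y)) \<and> (pr x y \<longleftrightarrow> pr (h x) (h y))) \<longrightarrow>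
        (\<exists>\<alpha>. aut2 le pr \<alpha> \<and> (\<forall>x\<in>A. \<alpha> x = h x)))"

datatype fo = FLe nat nat | FEq nat nat | FNeg fo | FAnd fo fo | FEx nat fo

fun fo_sat :: "('a \<Rightarrow> 'a \<Rightarrow> bool) \<Rightarrow> (nat \<Rightarrow> 'a) \<Rightarrow> fo \<Rightarrow> bool" where
  "fo_sat le \<sigma> (FLe i j) = le (\<sigma> i) (\<sigma> j)"
| "fo_sat le \<sigma> (FEq i j) = (\<sigma> i = \<sigma> j)"
| "fo_sat le \<sigma> (FNeg \<phi>) = (\<not> fo_sat le \<sigma> \<phi>)"
| "fo_sat le \<sigma> (FAnd \<phi> \<psi>) = (fo_sat le \<sigma> \<phi> \<and> fo_sat le \<sigma> \<psi>)"
| "fo_sat le \<sigma> (FEx i \<phi>) = (\<exists>a. fo_sat le (\<sigma>(i := a)) \<phi>)"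

definition fo_definable :: "('a \<Rightarrow> 'a \<Rightarrow> bool) \<Rightarrow> nat \<Rightarrow> 'a list set \<Rightarrow> bool" where
  "fo_definable le n R \<longleftrightarrow> R \<subseteq> {xs. length xs = n} \<and>
     (\<exists>\<phi>. \<forall>\<sigma>. map \<sigma> [0..<n] \<in> R \<longleftrightarrow> fo_sat le \<sigma> \<phi>)"

definition is_reduct :: "('a \<Rightarrow> 'a \<Rightarrow> bool) \<Rightarrow> 'a list set set \<Rightarrow> bool" where
  "is_reduct le \<Gamma> \<longleftrightarrow> (\<forall>R\<in>\<Gamma>. \<exists>n. fo_definable le n R)"

text \<open>Free variables 0..n-1; atoms are R(v_1..v_k) with R in \<Gamma>, and equalities;
  all other variables are existentially quantified.\<close>
definition pp_definable :: "'a list set set \<Rightarrow> nat \<Rightarrow> 'a list set \<Rightarrow> bool" where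
  "pp_definable \<Gamma> n S \<longleftrightarrow>
     (\<exists>(atoms :: ('a list set \<times> nat list) list) (eqs :: (nat \<times> nat) list).
        (\<forall>(R, vs)\<in>set atoms. R \<in> \<Gamma>) \<and>
        (\<forall>xs. xs \<in> S \<longleftrightarrow> length xs = n \<and>
           (\<exists>\<sigma> :: nat \<Rightarrow> 'a. (\<forall>i<n. \<sigma> i = xs ! i) \<and>
              (\<forall>(R, vs)\<in>set atoms. map \<sigma> vs \<in> R) \<and>
              (\<forall>(i, j)\<in>set eqs. \<sigma> i = \<sigma> j))))"

definition preserves2 :: "('a \<Rightarrow> 'a \<Rightarrow> 'a) \<Rightarrow> 'a list set \<Rightarrow> bool" where
  "preserves2 f R \<longleftrightarrow> (\<forall>xs\<in>R. \<forall>ys\<in>R. length xs = length ys \<longrightarrow> map2 f xs ys \<in> R)"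

definition binary_pol :: "'a list set set \<Rightarrow> ('a \<Rightarrow> 'a \<Rightarrow> 'a) \<Rightarrow> bool" where
  "binary_pol \<Gamma> f \<longleftrightarrow> (\<forall>R\<in>\<Gamma>. preserves2 f R)"

definition strict :: "('a \<Rightarrow> 'a \<Rightarrow> bool) \<Rightarrow> 'a \<Rightarrow> 'a \<Rightarrow> bool" where
  "strict le x y \<longleftrightarrow> le x y \<and> x \<noteq> y"

definition incomp :: "('a \<Rightarrow> 'a \<Rightarrow> bool) \<Rightarrow> 'a \<Rightarrow> 'a \<Rightarrow> bool" where
  "incomp le x y \<longleftrightarrow> \<not> le x y \<and> \<not> le y x"

definition canonical2 :: "('a \<Rightarrow> 'a \<Rightarrow> bool) \<Rightarrow> ('a \<Rightarrow> 'a \<Rightarrow> bool) \<Rightarrow> ('a \<Rightarrow> 'a \<Rightarrow> 'a) \<Rightarrow> bool" where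
  "canonical2 le pr f \<longleftrightarrow>
     (\<forall>(s::nat) \<alpha>1 \<alpha>2 d1 d2. s \<ge> 1 \<and> aut2 le pr \<alpha>1 \<and> aut2 le pr \<alpha>2 \<and>
        length d1 = s \<and> length d2 = s \<longrightarrow>
        (\<exists>\<beta>. aut1 le \<beta> \<and> map2 f (map \<alpha>1 d1) (map \<alpha>2 d2) = map \<beta> (map2 f d1 d2)))"

definition dominated_first :: "('a \<Rightarrow> 'a \<Rightarrow> bool) \<Rightarrow> ('a \<Rightarrow> 'a \<Rightarrow> 'a) \<Rightarrow> bool" where
  "dominated_first le f \<longleftrightarrow>
     (\<forall>x y x' y'. (strict le x x' \<longrightarrow> strict le (f x y) (f x' y')) \<and>
                  (incomp le x x' \<longrightarrow> incomp le (f x y) (f x' y')))"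

definition dominated :: "('a \<Rightarrow> 'a \<Rightarrow> bool) \<Rightarrow> ('a \<Rightarrow> 'a \<Rightarrow> 'a) \<Rightarrow> bool" where
  "dominated le f \<longleftrightarrow> dominated_first le f \<or> dominated_first le (\<lambda>x y. f y x)"

definition is_e_lt :: "('a \<Rightarrow> 'a \<Rightarrow> bool) \<Rightarrow> ('a \<Rightarrow> 'a \<Rightarrow> 'a) \<Rightarrow> bool" where
  "is_e_lt le e \<longleftrightarrow> inj (\<lambda>(a, b). e a b) \<and>
     (\<forall>a b a' b'. strict le (e a b) (e a' b') \<longleftrightarrow> strict le a a' \<and> strict le b b')"

definition is_e_le :: "('a \<Rightarrow> 'a \<Rightarrow> bool) \<Rightarrow> ('a \<Rightarrow> 'a \<Rightarrow> 'a) \<Rightarrow> bool" where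
  "is_e_le le e \<longleftrightarrow> inj (\<lambda>(a, b). e a b) \<and>
     (\<forall>a b a' b'. le (e a b) (e a' b') \<longleftrightarrow> le a a' \<and> le b b')"

end

theory Submission
  imports Defs
begin

text \<open>By canonicity the order type of \<open>f x y\<close> and \<open>f x' y'\<close> depends only on the types of \<open>(x, x')\<close>
  and \<open>(y, y')\<close> in \<open>(P; \<le>, \<prec>)\<close>. If \<open>f\<close> is not dominated, then \<open>x < x'\<close> and \<open>y > y'\<close> give incomparable
  values, and comparing triples of points leaves few other possibilities: up to exchanging the
  arguments, incomparable \<open>x, x'\<close> always give incomparable values, and so do \<open>x < x'\<close> with
  incomparable \<open>y \<succ> y'\<close>.

  A relation of \<open>\<Gamma>\<close> is first-order definable, so membership of a tuple depends only on its
  \<open>\<le>\<close>-type. Given tuples \<open>r, s\<close> in it, start with \<open>z = f(r, s)\<close> and \<open>w = f(s, r)\<close>. Whenever \<open>z\<close> has a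
  comparability that the target embedding does not have, \<open>w\<close> is incomparable at these two
  entries, so \<open>w\<close> has a copy of the same \<open>\<le>\<close>-type in which they are linearly ordered the other way;
  applying \<open>f\<close> to \<open>z\<close> and this copy removes the comparability. The result has the type of \<open>e\<^sub>\<le>(r, s)\<close>
  if \<open>f\<close> is strictly increasing in each argument with the other one fixed, and of \<open>e\<^sub><(r, s)\<close> otherwise.\<close>

section \<open>Order laws of the limit structure\<close>

lemma po_lin_on_inj:
  assumes "po_lin_on B le' pr'" "g ` I \<subseteq> B" "inj_on g I"
  shows "po_lin_on I (\<lambda>i j. le' (g i) (g j)) (\<lambda>i j. pr' (g i) (g j))"
  using assms unfolding po_lin_on_def inj_on_def image_subset_iff
  by (elim conjE, intro conjI) meson+

locale random_ordered_poset =
  fixes le pr :: "'a \<Rightarrow> 'a \<Rightarrow> bool"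
  assumes fraisse: "fraisse_limit_K le pr"
begin

abbreviation lt where "lt \<equiv> strict le"
abbreviation inc where "inc \<equiv> incomp le"
abbreviation inc_pr where "inc_pr x y \<equiv> incomp le x y \<and> pr x y"

lemma po_lin_on_finite: "finite A \<Longrightarrow> po_lin_on A le pr"
  using fraisse by (simp add: fraisse_limit_K_def)

lemma le_refl [simp]: "le x x"
  using po_lin_on_finite[of "{x}"] by (simp add: po_lin_on_def)

lemma le_antisym: "le x y \<Longrightarrow> le y x \<Longrightarrow> x = y"
  using po_lin_on_finite[of "{x, y}"] unfolding po_lin_on_def by blast

lemma le_trans: "le x y \<Longrightarrow> le y z \<Longrightarrow> le x z"
  using po_lin_on_finite[of "{x, y, z}"] unfolding po_lin_on_def by blast

lemma pr_irrefl [simp]: "\<not> pr x x"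
  using po_lin_on_finite[of "{x}"] by (simp add: po_lin_on_def)

lemma pr_trans: "pr x y \<Longrightarrow> pr y z \<Longrightarrow> pr x z"
  using po_lin_on_finite[of "{x, y, z}"] unfolding po_lin_on_def by blast

lemma pr_total: "x \<noteq> y \<Longrightarrow> pr x y \<or> pr y x"
  using po_lin_on_finite[of "{x, y}"] unfolding po_lin_on_def by blast

lemma le_imp_pr: "le x y \<Longrightarrow> x \<noteq> y \<Longrightarrow> pr x y"
  using po_lin_on_finite[of "{x, y}"] unfolding po_lin_on_def by blast

lemma pr_asym: "pr x y \<Longrightarrow> \<not> pr y x"
  using pr_trans pr_irrefl by blast

lemma lt_imp_pr: "lt x y \<Longrightarrow> pr x y"
  by (simp add: strict_def le_imp_pr)

lemma lt_le: "lt x y \<Longrightarrow> le x y"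
  by (simp add: strict_def)

lemma lt_not_le: "lt x y \<Longrightarrow> \<not> le y x"
  using le_antisym by (auto simp: strict_def)

lemma le_lt_trans: "le x y \<Longrightarrow> lt y z \<Longrightarrow> lt x z"
  using le_trans le_antisym unfolding strict_def by blast

lemma lt_le_trans: "lt x y \<Longrightarrow> le y z \<Longrightarrow> lt x z"
  using le_trans le_antisym unfolding strict_def by blast

lemma inc_sym: "inc x y \<Longrightarrow> inc y x"
  by (simp add: incomp_def)

lemma inc_pr_total: "inc x y \<Longrightarrow> pr x y \<or> pr y x"
  by (metis incomp_def le_refl pr_total)

lemma trichotomy [consumes 0, case_names eq lt gt inc]:
  assumes "x = y \<Longrightarrow> thesis" "lt x y \<Longrightarrow> thesis" "lt y x \<Longrightarrow> thesis" "inc x y \<Longrightarrow> thesis"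
  shows thesis
  using assms by (auto simp: strict_def incomp_def)

section \<open>Embedding finite structures, homogeneity, one-point extensions\<close>

text \<open>The age condition speaks only of structures on \<open>{..<n}\<close>; enumerating
  \<open>B\<close> transports it to finite sets of any type, such as the option type used for
  one-point extensions.\<close>

lemma embeds_finite:
  assumes "finite B" "po_lin_on B le' pr'"
  obtains e :: "'b \<Rightarrow> 'a" where
    "inj_on e B"
    "\<And>x y. x \<in> B \<Longrightarrow> y \<in> B \<Longrightarrow> le' x y \<longleftrightarrow> le (e x) (e y)"
    "\<And>x y. x \<in> B \<Longrightarrow> y \<in> B \<Longrightarrow> pr' x y \<longleftrightarrow> pr (e x) (e y)"
proof -
  obtain h where h: "bij_betw h B {0..<card B}"
    using ex_bij_betw_finite_nat[OF assms(1)] by blast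
  define g where "g = the_inv_into B h"
  have g: "bij_betw g {..<card B} B"
    using bij_betw_the_inv_into[OF h] by (simp add: g_def lessThan_atLeast0)
  have ginj: "inj_on g {..<card B}"
    using g by (simp add: bij_betw_def)
  have hB: "\<And>x. x \<in> B \<Longrightarrow> h x < card B" and hinj: "inj_on h B"
    using h by (auto simp: bij_betw_def)
  have gh: "\<And>x. x \<in> B \<Longrightarrow> g (h x) = x"
    using hinj by (simp add: g_def the_inv_into_f_f)
  have "po_lin_on {..<card B} (\<lambda>i j. le' (g i) (g j)) (\<lambda>i j. pr' (g i) (g j))"
    using po_lin_on_inj[OF assms(2) _ ginj] g by (simp add: bij_betw_def)
  then obtain e where e: "inj_on e {..<card B}"
    "\<forall>i\<in>{..<card B}. \<forall>j\<in>{..<card B}.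
       (le' (g i) (g j) \<longleftrightarrow> le (e i) (e j)) \<and> (pr' (g i) (g j) \<longleftrightarrow> pr (e i) (e j))"
    using fraisse[unfolded fraisse_limit_K_def, THEN conjunct2, THEN conjunct2, THEN conjunct1,
        THEN spec, THEN spec, THEN spec, THEN mp] by blast
  show thesis
  proof (rule that[of "e \<circ> h"])
    show "inj_on (e \<circ> h) B"
      using e(1) hinj hB by (auto simp: inj_on_def)
    show "le' x y \<longleftrightarrow> le ((e \<circ> h) x) ((e \<circ> h) y)" "pr' x y \<longleftrightarrow> pr ((e \<circ> h) x) ((e \<circ> h) y)"
      if "x \<in> B" "y \<in> B" for x y
      using e(2) hB gh that by (metis comp_apply lessThan_iff)+
  qed
qed

lemma homogeneous:
  assumes "finite A" "bij_betw h A B"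
    "\<And>x y. x \<in> A \<Longrightarrow> y \<in> A \<Longrightarrow> (le x y \<longleftrightarrow> le (h x) (h y)) \<and> (pr x y \<longleftrightarrow> pr (h x) (h y))"
  obtains \<alpha> where "aut2 le pr \<alpha>" "\<And>x. x \<in> A \<Longrightarrow> \<alpha> x = h x"
  using assms that fraisse[unfolded fraisse_limit_K_def, THEN conjunct2, THEN conjunct2,
      THEN conjunct2, THEN spec, THEN spec, THEN spec, THEN mp, of A h B] by blast

text \<open>\<open>D\<close> and \<open>U\<close> are the points below and above the new point, \<open>C\<close> is its cut in the linear order.\<close>
lemma one_point_extension:
  assumes A: "finite A" "D \<subseteq> C" "C \<subseteq> A" "U \<subseteq> A" "C \<inter> U = {}"
    and D: "\<forall>a\<in>A. \<forall>d\<in>D. le a d \<longrightarrow> a \<in> D"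
    and U: "\<forall>a\<in>A. \<forall>u\<in>U. le u a \<longrightarrow> a \<in> U"
    and C: "\<forall>a\<in>A. \<forall>c\<in>C. pr a c \<longrightarrow> a \<in> C"
    and DU: "\<forall>d\<in>D. \<forall>u\<in>U. le d u"
  shows "\<exists>p. p \<notin> A \<and> (\<forall>a\<in>A. (le a p \<longleftrightarrow> a \<in> D) \<and> (le p a \<longleftrightarrow> a \<in> U) \<and> (pr a p \<longleftrightarrow> a \<in> C))"
proof -
  \<comment> \<open>\<open>None\<close> stands for the new point, \<open>Some\<close> for the old
    ones.\<close>
  define le' where "le' u v = (case u of None \<Rightarrow> (case v of None \<Rightarrow> True | Some b \<Rightarrow> b \<in> U)
     | Some a \<Rightarrow> (case v of None \<Rightarrow> a \<in> D | Some b \<Rightarrow> le a b))" for u v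
  define pr' where "pr' u v = (case u of None \<Rightarrow> (case v of None \<Rightarrow> False | Some b \<Rightarrow> b \<notin> C)
     | Some a \<Rightarrow> (case v of None \<Rightarrow> a \<in> C | Some b \<Rightarrow> pr a b))" for u v
  define B where "B = insert None (Some ` A)"
  have "po_lin_on B le' pr'"
    unfolding po_lin_on_def
  proof (intro conjI)
    show "\<forall>x\<in>B. le' x x" "\<forall>x\<in>B. \<not> pr' x x"
      by (auto simp: B_def le'_def pr'_def)
    show "\<forall>x\<in>B. \<forall>y\<in>B. le' x y \<and> le' y x \<longrightarrow> x = y"
      using A(2,5) le_antisym unfolding B_def le'_def by (auto split: option.splits)
    show "\<forall>x\<in>B. \<forall>y\<in>B. \<forall>z\<in>B. le' x y \<and> le' y z \<longrightarrow> le' x z"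
    proof -
      have "le' x z" if "x \<in> B" "y \<in> B" "z \<in> B" "le' x y" "le' y z" for x y z
        using that
        by (cases x; cases y; cases z; simp add: B_def le'_def image_iff;
            use D U DU le_trans in blast)
      then show ?thesis by blast
    qed
    show "\<forall>x\<in>B. \<forall>y\<in>B. \<forall>z\<in>B. pr' x y \<and> pr' y z \<longrightarrow> pr' x z"
    proof -
      have "pr' x z" if "x \<in> B" "y \<in> B" "z \<in> B" "pr' x y" "pr' y z" for x y z
        using that
        by (cases x; cases y; cases z; simp add: B_def pr'_def image_iff;
            use C pr_trans pr_total in metis)
      then show ?thesis by blast
    qed
    show "\<forall>x\<in>B. \<forall>y\<in>B. x \<noteq> y \<longrightarrow> pr' x y \<or> pr' y x"
      by (auto simp: B_def pr'_def dest: pr_total)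
    show "\<forall>x\<in>B. \<forall>y\<in>B. le' x y \<and> x \<noteq> y \<longrightarrow> pr' x y"
      using A(2,5) by (auto simp: B_def le'_def pr'_def intro: le_imp_pr)
  qed
  moreover have "finite B" using assms(1) by (simp add: B_def)
  ultimately obtain e where e: "inj_on e B"
    "\<And>x y. x \<in> B \<Longrightarrow> y \<in> B \<Longrightarrow> le' x y \<longleftrightarrow> le (e x) (e y)"
    "\<And>x y. x \<in> B \<Longrightarrow> y \<in> B \<Longrightarrow> pr' x y \<longleftrightarrow> pr (e x) (e y)"
    using embeds_finite by metis
  \<comment> \<open>The limit contains a copy \<open>E\<close> of \<open>A\<close> together with a
    point \<open>e None\<close> in the right position. Homogeneity moves \<open>E\<close> back onto
    \<open>A\<close>, and the image of \<open>e None\<close> is the required point.\<close>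
  define E where "E = (\<lambda>a. e (Some a)) ` A"
  define h where "h = the_inv_into A (\<lambda>a. e (Some a))"
  have inj: "inj_on (\<lambda>a. e (Some a)) A"
    using e(1) by (auto simp: inj_on_def B_def)
  have h: "\<And>a. a \<in> A \<Longrightarrow> h (e (Some a)) = a"
    by (simp add: h_def the_inv_into_f_f[OF inj])
  have "bij_betw h E A"
    unfolding h_def E_def using inj by (intro bij_betw_the_inv_into inj_on_imp_bij_betw)
  moreover have "(le x y \<longleftrightarrow> le (h x) (h y)) \<and> (pr x y \<longleftrightarrow> pr (h x) (h y))" if "x \<in> E" "y \<in> E" for x y
  proof -
    obtain a b where ab: "a \<in> A" "b \<in> A" "x = e (Some a)" "y = e (Some b)"
      using \<open>x \<in> E\<close> \<open>y \<in> E\<close> by (auto simp: E_def)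
    show ?thesis
      using e(2)[of "Some a" "Some b"] e(3)[of "Some a" "Some b"] ab h
      by (simp add: B_def le'_def pr'_def)
  qed
  moreover have "finite E" using assms(1) by (simp add: E_def)
  ultimately obtain \<alpha> where \<alpha>: "aut2 le pr \<alpha>" "\<And>x. x \<in> E \<Longrightarrow> \<alpha> x = h x"
    using homogeneous[of E h A] by blast
  have \<alpha>e: "\<alpha> (e (Some a)) = a" if "a \<in> A" for a
    using \<alpha>(2)[of "e (Some a)"] h that by (simp add: E_def)
  have \<alpha>': "le x y \<longleftrightarrow> le (\<alpha> x) (\<alpha> y)" "pr x y \<longleftrightarrow> pr (\<alpha> x) (\<alpha> y)" for x y
    using \<alpha>(1) by (auto simp: aut2_def)
  show ?thesis
  proof (intro exI[of _ "\<alpha> (e None)"] conjI ballI)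
    show "\<alpha> (e None) \<notin> A"
    proof
      assume *: "\<alpha> (e None) \<in> A"
      have "\<alpha> (e (Some (\<alpha> (e None)))) = \<alpha> (e None)" using \<alpha>e * by blast
      then have "e (Some (\<alpha> (e None))) = e None"
        using \<alpha>(1) by (auto simp: aut2_def bij_def inj_def)
      then show False
        using e(1) * by (auto simp: inj_on_def B_def)
    qed
    fix a assume a: "a \<in> A"
    show "le a (\<alpha> (e None)) \<longleftrightarrow> a \<in> D"
      using e(2)[of "Some a" None] \<alpha>'(1)[of "e (Some a)" "e None"] \<alpha>e[OF a] a
      by (simp add: B_def le'_def)
    show "le (\<alpha> (e None)) a \<longleftrightarrow> a \<in> U"
      using e(2)[of None "Some a"] \<alpha>'(1)[of "e None" "e (Some a)"] \<alpha>e[OF a] a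
      by (simp add: B_def le'_def)
    show "pr a (\<alpha> (e None)) \<longleftrightarrow> a \<in> C"
      using e(3)[of "Some a" None] \<alpha>'(2)[of "e (Some a)" "e None"] \<alpha>e[OF a] a
      by (simp add: B_def pr'_def)
  qed
qed

text \<open>When the linear order is left open, the downward closure of \<open>D\<close> under
  \<open>pr\<close> serves as the cut. It misses \<open>U\<close> because every element of
  \<open>D\<close> lies strictly below every element of \<open>U\<close>.\<close>

lemma one_point_extension_le:
  assumes A: "finite A" "D \<subseteq> A" "U \<subseteq> A" "D \<inter> U = {}"
    and D: "\<forall>a\<in>A. \<forall>d\<in>D. le a d \<longrightarrow> a \<in> D"
    and U: "\<forall>a\<in>A. \<forall>u\<in>U. le u a \<longrightarrow> a \<in> U"
    and DU: "\<forall>d\<in>D. \<forall>u\<in>U. le d u"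
  shows "\<exists>p. p \<notin> A \<and> (\<forall>a\<in>A. (le a p \<longleftrightarrow> a \<in> D) \<and> (le p a \<longleftrightarrow> a \<in> U))"
proof -
  define C where "C = {a \<in> A. \<exists>d\<in>D. a = d \<or> pr a d}"
  have "False" if "d \<in> D" "u \<in> U" "u = d \<or> pr u d" for d u
    using DU that A(4) le_imp_pr[of d u] pr_asym[of u d] by blast
  then have CU: "C \<inter> U = {}"
    unfolding C_def by blast
  have CA: "D \<subseteq> C" "C \<subseteq> A"
    using A(2) unfolding C_def by blast+
  have C: "\<forall>a\<in>A. \<forall>c\<in>C. pr a c \<longrightarrow> a \<in> C"
    using pr_trans unfolding C_def by blast
  show ?thesis
    using one_point_extension[OF A(1) CA A(3) CU D U C DU] by blast
qed

section \<open>Points in prescribed positions\<close>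

lemma ex_lt_lt: "\<exists>z. lt x z \<and> lt y z"
  using one_point_extension_le[of "{x, y}" "{x, y}" "{}"] by (auto simp: strict_def)

lemma ex_gt_gt: "\<exists>z. lt z x \<and> lt z y"
  using one_point_extension_le[of "{x, y}" "{}" "{x, y}"] by (auto simp: strict_def)

lemma ex_inc: "\<exists>z. inc x z"
  using one_point_extension_le[of "{x}" "{}" "{}"] by (auto simp: incomp_def)

lemma ex_inc_above:
  assumes "inc x y" shows "\<exists>z. lt y z \<and> inc x z"
proof -
  have "x \<noteq> y" using assms by (auto simp: incomp_def)
  then show ?thesis
    using one_point_extension_le[of "{x, y}" "{y}" "{}"] assms by (auto simp: strict_def incomp_def)
qed

lemma ex_between:
  assumes "lt x y" shows "\<exists>z. lt x z \<and> lt z y"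
  using one_point_extension_le[of "{x, y}" "{x}" "{y}"] assms lt_not_le[OF assms]
  by (auto simp: strict_def)

lemma ex_inc_pr_between:
  assumes "lt x y" shows "\<exists>z. inc_pr x z \<and> inc_pr z y"
proof -
  have "x \<noteq> y" "\<not> pr y x" using assms lt_imp_pr[OF assms] pr_asym by (auto simp: strict_def)
  then obtain z where "z \<noteq> x" "z \<noteq> y" "inc x z" "inc z y" "pr x z" "\<not> pr y z"
    using one_point_extension[of "{x, y}" "{}" "{x}" "{}"] by (auto simp: incomp_def)
  then show ?thesis using pr_total by blast
qed

lemma ex_inc_pr_after: "\<exists>z. inc_pr x z \<and> inc_pr y z"
  using one_point_extension[of "{x, y}" "{}" "{x, y}" "{}"] by (auto simp: incomp_def)

lemma ex_inc_pr_before: "\<exists>z. inc_pr z x \<and> inc_pr z y"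
proof -
  obtain z where "z \<noteq> x" "z \<noteq> y" "inc z x" "inc z y" "\<not> pr x z" "\<not> pr y z"
    using one_point_extension[of "{x, y}" "{}" "{}" "{}"] by (auto simp: incomp_def)
  then show ?thesis using pr_total by blast
qed

lemma ex_lt_inc_pr:
  assumes "inc_pr x y" shows "\<exists>z. lt x z \<and> inc_pr z y"
proof -
  have "x \<noteq> y" "\<not> pr y x" "\<not> le y x" using assms pr_asym by (auto simp: incomp_def)
  then obtain z where "z \<noteq> x" "z \<noteq> y" "lt x z" "inc z y" "\<not> pr y z"
    using one_point_extension[of "{x, y}" "{x}" "{x}" "{}"] by (auto simp: strict_def incomp_def)
  then show ?thesis using pr_total by blast
qed

section \<open>First-order definable relations depend only on the order type\<close>

text \<open>An Ehrenfeucht--Fraisse argument: extending the partial isomorphism by one point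
  handles the quantifier.\<close>
lemma fo_sat_type_invariant:
  "\<exists>N. \<forall>\<sigma> \<tau>. (\<forall>i<N. \<forall>j<N. le (\<sigma> i) (\<sigma> j) \<longleftrightarrow> le (\<tau> i) (\<tau> j)) \<longrightarrow>
     fo_sat le \<sigma> \<phi> = fo_sat le \<tau> \<phi>"
proof (induction \<phi>)
  case (FLe i j)
  show ?case by (rule exI[of _ "Suc (max i j)"]) auto
next
  case (FEq i j)
  have "\<sigma> i = \<sigma> j \<longleftrightarrow> le (\<sigma> i) (\<sigma> j) \<and> le (\<sigma> j) (\<sigma> i)" for \<sigma>
    using le_antisym by auto
  then show ?case by (intro exI[of _ "Suc (max i j)"]) auto
next
  case (FNeg \<phi>)
  then show ?case by auto
next
  case (FAnd \<phi> \<psi>)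
  then obtain N M where
    N: "\<And>\<sigma> \<tau>. (\<forall>i<N. \<forall>j<N. le (\<sigma> i) (\<sigma> j) \<longleftrightarrow> le (\<tau> i) (\<tau> j)) \<Longrightarrow> fo_sat le \<sigma> \<phi> = fo_sat le \<tau> \<phi>" and
    M: "\<And>\<sigma> \<tau>. (\<forall>i<M. \<forall>j<M. le (\<sigma> i) (\<sigma> j) \<longleftrightarrow> le (\<tau> i) (\<tau> j)) \<Longrightarrow> fo_sat le \<sigma> \<psi> = fo_sat le \<tau> \<psi>"
    by blast
  show ?case
  proof (intro exI[of _ "max N M"] allI impI)
    fix \<sigma> \<tau> assume "\<forall>i<max N M. \<forall>j<max N M. le (\<sigma> i) (\<sigma> j) \<longleftrightarrow> le (\<tau> i) (\<tau> j)"
    then show "fo_sat le \<sigma> (FAnd \<phi> \<psi>) = fo_sat le \<tau> (FAnd \<phi> \<psi>)"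
      using N[of \<sigma> \<tau>] M[of \<sigma> \<tau>] by simp
  qed
next
  case (FEx k \<phi>)
  then obtain N where N:
    "\<And>\<sigma> \<tau>. (\<forall>i<N. \<forall>j<N. le (\<sigma> i) (\<sigma> j) \<longleftrightarrow> le (\<tau> i) (\<tau> j)) \<Longrightarrow> fo_sat le \<sigma> \<phi> = fo_sat le \<tau> \<phi>"
    by blast
  have forth: "\<exists>b. fo_sat le (\<tau>(k := b)) \<phi>"
    if st: "\<forall>i<N. \<forall>j<N. le (\<sigma> i) (\<sigma> j) \<longleftrightarrow> le (\<tau> i) (\<tau> j)" and a: "fo_sat le (\<sigma>(k := a)) \<phi>"
    for \<sigma> \<tau> a
  proof -
    have "\<exists>b. \<forall>i<N. i \<noteq> k \<longrightarrow> (le (\<sigma> i) a \<longleftrightarrow> le (\<tau> i) b) \<and> (le a (\<sigma> i) \<longleftrightarrow> le b (\<tau> i))"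
    proof (cases "\<exists>i<N. a = \<sigma> i")
      case True
      then show ?thesis using st by blast
    next
      case False
      \<comment> \<open>The sets of points below and above \<open>a\<close> are transported from the
        values of \<open>\<sigma>\<close> to those of \<open>\<tau>\<close>. They are disjoint
        because \<open>a\<close> differs from every \<open>\<sigma> i\<close>.\<close>
      define D where "D = \<tau> ` {i. i < N \<and> le (\<sigma> i) a}"
      define U where "U = \<tau> ` {i. i < N \<and> le a (\<sigma> i)}"
      have "\<exists>b. b \<notin> \<tau> ` {..<N} \<and> (\<forall>c\<in>\<tau> ` {..<N}. (le c b \<longleftrightarrow> c \<in> D) \<and> (le b c \<longleftrightarrow> c \<in> U))"
      proof (rule one_point_extension_le)
        have False if "i < N" "j < N" "le (\<sigma> i) a" "le a (\<sigma> j)" "\<tau> i = \<tau> j" for i j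
        proof -
          have "le (\<sigma> j) (\<sigma> i)" using st that by simp
          then have "a = \<sigma> i" using that le_trans le_antisym by blast
          then show False using False that by blast
        qed
        then show "D \<inter> U = {}" unfolding D_def U_def by blast
        show "\<forall>c\<in>\<tau> ` {..<N}. \<forall>d\<in>D. le c d \<longrightarrow> c \<in> D"
          using st le_trans unfolding D_def by blast
        show "\<forall>c\<in>\<tau> ` {..<N}. \<forall>d\<in>U. le d c \<longrightarrow> c \<in> U"
          using st le_trans unfolding U_def by blast
        show "\<forall>d\<in>D. \<forall>u\<in>U. le d u"
          using st le_trans unfolding D_def U_def by blast
      qed (auto simp: D_def U_def)
      then obtain b where b: "\<And>c. c \<in> \<tau> ` {..<N} \<Longrightarrow> le c b \<longleftrightarrow> c \<in> D"
          "\<And>c. c \<in> \<tau> ` {..<N} \<Longrightarrow> le b c \<longleftrightarrow> c \<in> U"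
        by blast
      have "le (\<sigma> i) a \<longleftrightarrow> le (\<tau> i) b" if "i < N" for i
      proof -
        \<comment> \<open>\<open>\<tau>\<close> may repeat values, so membership of
          \<open>\<tau> i\<close> in \<open>D\<close> can be witnessed by another index
          \<open>j\<close>.\<close>
        have "le (\<sigma> i) a" if "\<tau> i = \<tau> j" "le (\<sigma> j) a" "j < N" for j
          using st that \<open>i < N\<close> le_trans by (metis le_refl)
        then show ?thesis using b(1)[of "\<tau> i"] that by (auto simp: D_def)
      qed
      moreover have "le a (\<sigma> i) \<longleftrightarrow> le b (\<tau> i)" if "i < N" for i
      proof -
        have "le a (\<sigma> i)" if "\<tau> i = \<tau> j" "le a (\<sigma> j)" "j < N" for j
          using st that \<open>i < N\<close> le_trans by (metis le_refl)
        then show ?thesis using b(2)[of "\<tau> i"] that by (auto simp: U_def)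
      qed
      ultimately show ?thesis by blast
    qed
    then obtain b where "\<forall>i<N. i \<noteq> k \<longrightarrow> (le (\<sigma> i) a \<longleftrightarrow> le (\<tau> i) b) \<and> (le a (\<sigma> i) \<longleftrightarrow> le b (\<tau> i))"
      by blast
    then have "fo_sat le (\<sigma>(k := a)) \<phi> = fo_sat le (\<tau>(k := b)) \<phi>"
      using st by (intro N) simp
    then show ?thesis using a by blast
  qed
  show ?case
  proof (intro exI[of _ N] allI impI)
    fix \<sigma> \<tau> assume st: "\<forall>i<N. \<forall>j<N. le (\<sigma> i) (\<sigma> j) \<longleftrightarrow> le (\<tau> i) (\<tau> j)"
    then show "fo_sat le \<sigma> (FEx k \<phi>) = fo_sat le \<tau> (FEx k \<phi>)"
      using forth[of \<sigma> \<tau>] forth[of \<tau> \<sigma>] by auto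
  qed
qed

lemma fo_definable_type_invariant:
  assumes R: "fo_definable le n R" and z: "map z [0..<n] \<in> R"
    and eq: "\<And>i j. i < n \<Longrightarrow> j < n \<Longrightarrow> le (z i) (z j) \<longleftrightarrow> le (z' i) (z' j)"
  shows "map z' [0..<n] \<in> R"
proof (cases n)
  case 0
  then show ?thesis using z by simp
next
  case (Suc m)
  obtain \<phi> where \<phi>: "\<And>\<sigma>. map \<sigma> [0..<n] \<in> R \<longleftrightarrow> fo_sat le \<sigma> \<phi>"
    using R by (auto simp: fo_definable_def)
  obtain N where N: "\<And>\<sigma> \<tau>. (\<forall>i<N. \<forall>j<N. le (\<sigma> i) (\<sigma> j) \<longleftrightarrow> le (\<tau> i) (\<tau> j)) \<Longrightarrow>
     fo_sat le \<sigma> \<phi> = fo_sat le \<tau> \<phi>"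
    using fo_sat_type_invariant[of \<phi>] by blast
  \<comment> \<open>The formula may mention variables beyond \<open>n\<close>. Redirecting them to
    index 0, which exists since \<open>n\<close> is positive, makes the two assignments agree in
    type on all indices.\<close>
  define c where "c i = (if i < n then i else 0)" for i
  have c: "c i < n" for i using Suc by (simp add: c_def)
  have m: "map (\<lambda>i. s (c i)) [0..<n] = map s [0..<n]" for s :: "nat \<Rightarrow> 'a"
    by (simp add: c_def)
  have "fo_sat le (\<lambda>i. z (c i)) \<phi> = fo_sat le (\<lambda>i. z' (c i)) \<phi>"
    using eq c by (intro N) blast
  then show ?thesis using z by (metis \<phi> m)
qed

text \<open>Moving the lower set of \<open>w l\<close> to the front of the linear order puts \<open>w l\<close> before \<open>w k\<close>.\<close>
lemma reorder_incomparable_pair: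
  fixes w :: "nat \<Rightarrow> 'a"
  assumes "inc (w k) (w l)" "k < n" "l < n"
  obtains w' where "\<And>i j. i < n \<Longrightarrow> j < n \<Longrightarrow> le (w i) (w j) \<longleftrightarrow> le (w' i) (w' j)" "pr (w' l) (w' k)"
proof -
  define pr' where "pr' x y \<longleftrightarrow> (le x (w l) \<and> \<not> le y (w l)) \<or> ((le x (w l) \<longleftrightarrow> le y (w l)) \<and> pr x y)" for x y
  have "po_lin_on (w ` {..<n}) le pr'"
    unfolding po_lin_on_def
  proof (intro conjI)
    show "\<forall>x\<in>w ` {..<n}. \<forall>y\<in>w ` {..<n}. le x y \<and> le y x \<longrightarrow> x = y"
      using le_antisym by blast
    show "\<forall>x\<in>w ` {..<n}. \<forall>y\<in>w ` {..<n}. \<forall>z\<in>w ` {..<n}. le x y \<and> le y z \<longrightarrow> le x z"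
      using le_trans by blast
    show "\<forall>x\<in>w ` {..<n}. \<forall>y\<in>w ` {..<n}. \<forall>z\<in>w ` {..<n}. pr' x y \<and> pr' y z \<longrightarrow> pr' x z"
      unfolding pr'_def using pr_trans by blast
    show "\<forall>x\<in>w ` {..<n}. \<forall>y\<in>w ` {..<n}. x \<noteq> y \<longrightarrow> pr' x y \<or> pr' y x"
      unfolding pr'_def using pr_total by blast
    show "\<forall>x\<in>w ` {..<n}. \<forall>y\<in>w ` {..<n}. le x y \<and> x \<noteq> y \<longrightarrow> pr' x y"
      unfolding pr'_def using le_imp_pr le_trans by blast
  qed (auto simp: pr'_def)
  then obtain e where e:
    "\<And>x y. x \<in> w ` {..<n} \<Longrightarrow> y \<in> w ` {..<n} \<Longrightarrow> le x y \<longleftrightarrow> le (e x) (e y)"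
    "\<And>x y. x \<in> w ` {..<n} \<Longrightarrow> y \<in> w ` {..<n} \<Longrightarrow> pr' x y \<longleftrightarrow> pr (e x) (e y)"
    using embeds_finite[of "w ` {..<n}" le pr'] by (metis finite_imageI finite_lessThan)
  show thesis
  proof (rule that[of "\<lambda>i. e (w i)"])
    show "le (w i) (w j) \<longleftrightarrow> le (e (w i)) (e (w j))" if "i < n" "j < n" for i j
      using e(1) that by simp
    have "pr' (w l) (w k)" using assms(1) by (simp add: pr'_def incomp_def)
    then show "pr (e (w l)) (e (w k))" using e(2) assms(2,3) by simp
  qed
qed

end

section \<open>Polymorphisms and exchange of arguments\<close>

text \<open>Applying \<open>f\<close> pointwise to two witnessing assignments yields a witnessing
  assignment, since atoms are preserved by \<open>f\<close> and equalities by any function.\<close>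

lemma pp_definable_preserved:
  assumes "pp_definable \<Gamma> n S" "binary_pol \<Gamma> f"
  shows "preserves2 f S"
  unfolding preserves2_def
proof (intro ballI impI)
  fix xs ys assume xs: "xs \<in> S" and ys: "ys \<in> S"
  obtain atoms eqs where at: "\<forall>(R, vs)\<in>set atoms. R \<in> \<Gamma>" and
    S: "\<And>xs. xs \<in> S \<longleftrightarrow> length xs = n \<and> (\<exists>\<sigma>. (\<forall>i<n. \<sigma> i = xs ! i) \<and>
          (\<forall>(R, vs)\<in>set atoms. map \<sigma> vs \<in> R) \<and> (\<forall>(i, j)\<in>set eqs. \<sigma> i = \<sigma> j))"
    using assms(1) unfolding pp_definable_def by blast
  from xs obtain \<sigma> where s: "length xs = n" "\<forall>i<n. \<sigma> i = xs ! i"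
    "\<forall>(R, vs)\<in>set atoms. map \<sigma> vs \<in> R" "\<forall>(i, j)\<in>set eqs. \<sigma> i = \<sigma> j"
    using S by blast
  from ys obtain \<tau> where t: "length ys = n" "\<forall>i<n. \<tau> i = ys ! i"
    "\<forall>(R, vs)\<in>set atoms. map \<tau> vs \<in> R" "\<forall>(i, j)\<in>set eqs. \<tau> i = \<tau> j"
    using S by blast
  have "map (\<lambda>i. f (\<sigma> i) (\<tau> i)) vs \<in> R" if "(R, vs) \<in> set atoms" for R vs
  proof -
    have "preserves2 f R" using at assms(2) that by (auto simp: binary_pol_def)
    moreover have "map \<sigma> vs \<in> R" "map \<tau> vs \<in> R" using s(3) t(3) that by auto
    ultimately have "map2 f (map \<sigma> vs) (map \<tau> vs) \<in> R" by (simp add: preserves2_def)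
    moreover have "map2 f (map \<sigma> vs) (map \<tau> vs) = map (\<lambda>i. f (\<sigma> i) (\<tau> i)) vs"
      by (induction vs) auto
    ultimately show ?thesis by simp
  qed
  moreover have "f (\<sigma> i) (\<tau> i) = f (\<sigma> j) (\<tau> j)" if "(i, j) \<in> set eqs" for i j
    using s(4) t(4) that by fastforce
  ultimately show "map2 f xs ys \<in> S"
    unfolding S using s t by (auto intro!: exI[of _ "\<lambda>i. f (\<sigma> i) (\<tau> i)"])
qed

lemma preserves2_swap:
  assumes "preserves2 f R" shows "preserves2 (\<lambda>x y. f y x) R"
  unfolding preserves2_def
proof (intro ballI impI)
  fix xs ys assume "xs \<in> R" "ys \<in> R" "length xs = length ys"
  then have "map2 f ys xs \<in> R" using assms by (simp add: preserves2_def)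
  moreover have "map2 f ys xs = map2 (\<lambda>x y. f y x) xs ys"
    using \<open>length xs = length ys\<close> by (induction rule: list_induct2) auto
  ultimately show "map2 (\<lambda>x y. f y x) xs ys \<in> R" by simp
qed

lemma binary_pol_swap: "binary_pol \<Gamma> f \<Longrightarrow> binary_pol \<Gamma> (\<lambda>x y. f y x)"
  by (simp add: binary_pol_def preserves2_swap)

lemma canonical2_swap:
  assumes "canonical2 le pr f" shows "canonical2 le pr (\<lambda>x y. f y x)"
  unfolding canonical2_def
proof (intro allI impI, elim conjE)
  fix s :: nat and \<alpha>1 \<alpha>2 and d1 d2 :: "'a list"
  assume "1 \<le> s" "aut2 le pr \<alpha>1" "aut2 le pr \<alpha>2" and l: "length d1 = s" "length d2 = s"
  then obtain \<beta> where b: "aut1 le \<beta>" "map2 f (map \<alpha>2 d2) (map \<alpha>1 d1) = map \<beta> (map2 f d2 d1)"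
    using assms unfolding canonical2_def by blast
  have "map2 (\<lambda>x y. f y x) xs ys = map2 f ys xs" if "length xs = length ys" for xs ys
    using that by (induction rule: list_induct2) auto
  with b l show "\<exists>\<beta>. aut1 le \<beta> \<and> map2 (\<lambda>x y. f y x) (map \<alpha>1 d1) (map \<alpha>2 d2) =
      map \<beta> (map2 (\<lambda>x y. f y x) d1 d2)"
    by auto
qed

section \<open>Canonical operations preserving \<open><\<close> and incomparability\<close>

locale canonical_op = random_ordered_poset le pr for le pr :: "'a \<Rightarrow> 'a \<Rightarrow> bool" +
  fixes f :: "'a \<Rightarrow> 'a \<Rightarrow> 'a"
  assumes canonical: "canonical2 le pr f"
    and f_lt: "preserves2 f {[x, y] | x y. strict le x y}"
    and f_inc: "preserves2 f {[x, y] | x y. incomp le x y}"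
begin

text \<open>By homogeneity this is the orbit equivalence of pairs under automorphisms of
  \<open>(P; \<le>, \<prec>)\<close>. The value of \<open>pr y x\<close> is determined by the rest
  because \<open>pr\<close> is total.\<close>

definition same_type :: "'a \<Rightarrow> 'a \<Rightarrow> 'a \<Rightarrow> 'a \<Rightarrow> bool" where
  "same_type x y u v \<longleftrightarrow> (le x y \<longleftrightarrow> le u v) \<and> (le y x \<longleftrightarrow> le v u) \<and> (pr x y \<longleftrightarrow> pr u v)"

lemma lt_lt: "lt x x' \<Longrightarrow> lt y y' \<Longrightarrow> lt (f x y) (f x' y')"
  using f_lt[unfolded preserves2_def, THEN bspec, THEN bspec, of "[x, x']" "[y, y']"] by simp

lemma inc_inc: "inc x x' \<Longrightarrow> inc y y' \<Longrightarrow> inc (f x y) (f x' y')"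
  using f_inc[unfolded preserves2_def, THEN bspec, THEN bspec, of "[x, x']" "[y, y']"] by simp

lemma same_type_aut:
  assumes "same_type x y u v"
  obtains \<alpha> where "aut2 le pr \<alpha>" "\<alpha> x = u" "\<alpha> y = v"
proof -
  define h where "h z = (if z = x then u else v)" for z
  have eq: "x = y \<longleftrightarrow> u = v" using assms le_antisym by (auto simp: same_type_def)
  have "pr y x \<longleftrightarrow> pr v u"
    using assms eq pr_total pr_asym pr_irrefl unfolding same_type_def by metis
  then have "(le a b \<longleftrightarrow> le (h a) (h b)) \<and> (pr a b \<longleftrightarrow> pr (h a) (h b))" if "a \<in> {x, y}" "b \<in> {x, y}" for a b
    using that assms eq by (auto simp: h_def same_type_def)
  moreover have "bij_betw h {x, y} {u, v}"
    using eq by (auto simp: bij_betw_def h_def inj_on_def)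
  ultimately obtain \<alpha> where "aut2 le pr \<alpha>" "\<And>z. z \<in> {x, y} \<Longrightarrow> \<alpha> z = h z"
    using homogeneous[of "{x, y}" h "{u, v}"] by blast
  then show thesis using that[of \<alpha>] eq by (auto simp: h_def)
qed

text \<open>Canonicity for tuples of length two: a comparison observed at one choice of arguments
  transfers to all arguments of the same types.\<close>

lemma canonical_le:
  assumes "same_type x x' u u'" "same_type y y' v v'"
  shows "le (f x y) (f x' y') \<longleftrightarrow> le (f u v) (f u' v')"
    and "le (f x' y') (f x y) \<longleftrightarrow> le (f u' v') (f u v)"
proof -
  obtain \<alpha> where \<alpha>: "aut2 le pr \<alpha>" "\<alpha> x = u" "\<alpha> x' = u'" using same_type_aut[OF assms(1)] .
  obtain \<gamma> where \<gamma>: "aut2 le pr \<gamma>" "\<gamma> y = v" "\<gamma> y' = v'" using same_type_aut[OF assms(2)] .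
  have "\<exists>\<beta>. aut1 le \<beta> \<and> map2 f (map \<alpha> [x, x']) (map \<gamma> [y, y']) = map \<beta> (map2 f [x, x'] [y, y'])"
    using canonical \<alpha>(1) \<gamma>(1) unfolding canonical2_def
    by (metis One_nat_def Suc_le_mono le0 length_Cons)
  then obtain \<beta> where "aut1 le \<beta>" "f u v = \<beta> (f x y)" "f u' v' = \<beta> (f x' y')"
    using \<alpha> \<gamma> by auto
  then show "le (f x y) (f x' y') \<longleftrightarrow> le (f u v) (f u' v')"
    "le (f x' y') (f x y) \<longleftrightarrow> le (f u' v') (f u v)"
    by (auto simp: aut1_def)
qed

lemma same_type_refl: "same_type x x y y"
  by (simp add: same_type_def)

lemma same_type_lt: "lt x y \<Longrightarrow> lt u v \<Longrightarrow> same_type x y u v"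
  using lt_not_le lt_le lt_imp_pr by (simp add: same_type_def)

lemma same_type_gt: "lt y x \<Longrightarrow> lt v u \<Longrightarrow> same_type x y u v"
  using lt_not_le lt_le lt_imp_pr pr_asym by (simp add: same_type_def)

lemma same_type_inc_pr: "inc_pr x y \<Longrightarrow> inc_pr u v \<Longrightarrow> same_type x y u v"
  by (simp add: same_type_def incomp_def)

lemma same_type_inc_pr': "inc_pr y x \<Longrightarrow> inc_pr v u \<Longrightarrow> same_type x y u v"
  using pr_asym by (simp add: same_type_def incomp_def)

text \<open>Canonicity extends the comparison to all pairs of these types. For
  \<open>x < x'\<close>, an intermediate \<open>x''\<close> and some \<open>y''\<close> above
  \<open>y\<close> and \<open>y'\<close> give \<open>f x y < f x'' y'' \<le> f x' y'\<close>. For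
  incomparable \<open>x\<close>, \<open>x'\<close>, a comparability of values could be prolonged to
  some \<open>x'' > x'\<close> incomparable to \<open>x\<close> and some \<open>y''\<close>
  incomparable to \<open>y\<close>, against \<open>inc_inc\<close>.\<close>

lemma dominated_first_if_lt_gt:
  assumes "lt a a'" "lt b' b" "le (f a b) (f a' b')"
  shows "dominated_first le f"
proof -
  have gt: "le (f x y) (f x' y')" if "lt x x'" "lt y' y" for x x' y y'
    using canonical_le(1)[OF same_type_lt[OF assms(1) that(1)] same_type_gt[OF assms(2) that(2)]]
      assms(3) by blast
  have lt: "lt (f x y) (f x' y')" if xx': "lt x x'" for x x' y y'
  proof -
    obtain x'' where x: "lt x x''" "lt x'' x'" using ex_between[OF xx'] by blast
    obtain y'' where y: "lt y y''" "lt y' y''" using ex_lt_lt by blast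
    show ?thesis using lt_le_trans[OF lt_lt[OF x(1) y(1)] gt[OF x(2) y(2)]] .
  qed
  have nle: "\<not> le (f x y) (f x' y')" if x: "inc x x'" for x x' y y'
  proof
    assume le: "le (f x y) (f x' y')"
    obtain x'' where "lt x' x''" "inc x x''" using ex_inc_above x by blast
    moreover obtain y'' where "inc y y''" using ex_inc by blast
    ultimately show False
      using le_lt_trans[OF le lt[of x' x'' y' y'']] inc_inc[of x x'' y y'']
      by (simp add: strict_def incomp_def)
  qed
  show ?thesis
    using lt nle inc_sym by (auto simp: dominated_first_def incomp_def)
qed

end

section \<open>Reducing operations generate a product embedding\<close>

text \<open>Every canonical operation that preserves \<open><\<close> and incomparability and is not dominated
  behaves like this up to exchanging its arguments.\<close>
locale reducing_op = canonical_op +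
  assumes lt_gt: "lt x x' \<Longrightarrow> lt y' y \<Longrightarrow> inc (f x y) (f x' y')"
    and lt_inc_pr: "lt x x' \<Longrightarrow> inc y y' \<Longrightarrow> pr y' y \<Longrightarrow> inc (f x y) (f x' y')"
    and inc_lt: "inc x x' \<Longrightarrow> lt y y' \<Longrightarrow> inc (f x y) (f x' y')"
    and inc_eq: "inc x x' \<Longrightarrow> inc (f x y) (f x' y)"
    and lt_not_ge: "lt x x' \<Longrightarrow> \<not> le (f x' y') (f x y)"
    and eq_lt_not_ge: "lt y y' \<Longrightarrow> \<not> le (f x y') (f x y)"
    and eq_inc_not_eq: "inc y y' \<Longrightarrow> f x y \<noteq> f x y'"
begin

lemma inc_any: "inc x x' \<Longrightarrow> inc (f x y) (f x' y')"
  by (cases y y' rule: trichotomy) (auto intro: inc_eq inc_lt inc_inc inc_sym)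

lemma f_eq_iff: "f x y = f x' y' \<longleftrightarrow> x = x' \<and> y = y'"
proof
  assume eq: "f x y = f x' y'"
  have x: "x = x'"
    using eq lt_not_ge[of x x' y' y] lt_not_ge[of x' x y y'] inc_any[of x x' y y']
    by (cases x x' rule: trichotomy) (auto simp: incomp_def)
  moreover have "y = y'"
    using eq x eq_lt_not_ge[of y y' x] eq_lt_not_ge[of y' y x] eq_inc_not_eq[of y y' x]
    by (cases y y' rule: trichotomy) auto
  ultimately show "x = x' \<and> y = y'" by blast
qed simp

text \<open>Each pass removes one superfluous comparability \<open>z k < z l\<close>: a copy \<open>w'\<close> of \<open>w\<close> with
  \<open>w' l\<close> linearly before \<open>w' k\<close> makes \<open>f (z k) (w' k)\<close> and \<open>f (z l) (w' l)\<close> incomparable, and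
  applying \<open>f\<close> never creates a new comparability.\<close>
lemma remove_comparabilities:
  fixes z w :: "nat \<Rightarrow> 'a" and T :: "nat \<Rightarrow> nat \<Rightarrow> bool"
  assumes R: "fo_definable le n R" "preserves2 f R"
    and "map z [0..<n] \<in> R" and w: "map w [0..<n] \<in> R"
    and Tw: "\<And>a b. a < n \<Longrightarrow> b < n \<Longrightarrow> T a b \<Longrightarrow> lt (w a) (w b)"
    and "\<And>a b. a < n \<Longrightarrow> b < n \<Longrightarrow> T a b \<Longrightarrow> lt (z a) (z b)"
    and "\<And>a b. a < n \<Longrightarrow> b < n \<Longrightarrow> z a = z b \<longleftrightarrow> w a = w b"
    and "\<And>a b. a < n \<Longrightarrow> b < n \<Longrightarrow> lt (z a) (z b) \<Longrightarrow> \<not> T a b \<Longrightarrow> inc (w a) (w b)"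
  shows "\<exists>z'. map z' [0..<n] \<in> R \<and> (\<forall>a<n. \<forall>b<n. (lt (z' a) (z' b) \<longleftrightarrow> T a b) \<and> (z' a = z' b \<longleftrightarrow> w a = w b))"
  using assms(3,6-8)
proof (induction "card {(a, b). a < n \<and> b < n \<and> lt (z a) (z b) \<and> \<not> T a b}" arbitrary: z rule: less_induct)
  case (less z)
  let ?bad = "\<lambda>z. {(a, b). a < n \<and> b < n \<and> lt (z a) (z b) \<and> \<not> T a b}"
  show ?case
  proof (cases "?bad z = {}")
    case True
    then show ?thesis using less.prems by (intro exI[of _ z]) blast
  next
    case False
    then obtain k l where kl: "k < n" "l < n" "lt (z k) (z l)" "\<not> T k l" by blast
    then have "inc (w k) (w l)" using less.prems(4) by blast
    then obtain w' where w': "\<And>i j. i < n \<Longrightarrow> j < n \<Longrightarrow> le (w i) (w j) \<longleftrightarrow> le (w' i) (w' j)"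
      and pr: "pr (w' l) (w' k)"
      using reorder_incomparable_pair kl(1,2) by metis
    have w'R: "map w' [0..<n] \<in> R" using fo_definable_type_invariant[OF R(1) w w'] .
    have w'eq: "w i = w j \<longleftrightarrow> w' i = w' j" if "i < n" "j < n" for i j
      using w'[OF that] w'[OF that(2,1)] le_antisym by (metis le_refl)
    define z' where "z' i = f (z i) (w' i)" for i
    have "map2 f (map z [0..<n]) (map w' [0..<n]) \<in> R"
      using R(2) less.prems(1) w'R by (simp add: preserves2_def)
    moreover have "map2 f (map z [0..<n]) (map w' [0..<n]) = map z' [0..<n]"
      by (rule nth_equalityI) (simp_all add: z'_def)
    ultimately have z'R: "map z' [0..<n] \<in> R" by simp
    have Tz': "lt (z' a) (z' b)" if "a < n" "b < n" "T a b" for a b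
      using lt_lt less.prems(2)[OF that] Tw[OF that] w' w'eq that unfolding z'_def strict_def by simp
    have eqz': "z' a = z' b \<longleftrightarrow> w a = w b" if "a < n" "b < n" for a b
      using less.prems(3)[OF that] w'eq[OF that] by (auto simp: z'_def f_eq_iff)
    have ltz': "lt (z a) (z b)" if "lt (z' a) (z' b)" "a < n" "b < n" for a b
    proof (cases "z a" "z b" rule: trichotomy)
      case eq
      then show ?thesis using that eqz' less.prems(3) by (auto simp: strict_def)
    next
      case gt
      then show ?thesis using that(1) lt_not_ge[of "z b" "z a"] by (auto simp: z'_def strict_def)
    next
      case inc
      then show ?thesis using that(1) inc_any[of "z a" "z b"] by (auto simp: z'_def strict_def incomp_def)
    qed
    have "inc (w' k) (w' l)"
      using \<open>inc (w k) (w l)\<close> w' kl(1,2) by (simp add: incomp_def)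
    then have "inc (z' k) (z' l)"
      unfolding z'_def using lt_inc_pr kl(3) pr by blast
    then have "(k, l) \<notin> ?bad z'" by (auto simp: incomp_def strict_def)
    moreover have "?bad z' \<subseteq> ?bad z" using ltz' by blast
    moreover have "(k, l) \<in> ?bad z" using kl by blast
    ultimately have "?bad z' \<subset> ?bad z" by blast
    moreover have "finite (?bad z)"
      by (rule finite_subset[of _ "{..<n} \<times> {..<n}"]) auto
    ultimately have "card (?bad z') < card (?bad z)" by (rule psubset_card_mono[rotated])
    then show ?thesis
      using less.hyps[of z'] z'R Tz' eqz' ltz' less.prems(4) by blast
  qed
qed

text \<open>Pairs \<open>x < x'\<close> with a fixed second argument form one type, so canonicity
  forces uniform behaviour: \<open>f\<close> increases everywhere or gives incomparable values, the
  reverse order being excluded by \<open>lt_not_ge\<close>.\<close>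

lemma lt_eq_cases:
  assumes "lt x x'"
  shows "(\<forall>u u' v. lt u u' \<longrightarrow> lt (f u v) (f u' v)) \<or> inc (f x y) (f x' y)"
proof (cases "le (f x y) (f x' y)")
  case True
  have "lt (f u v) (f u' v)" if "lt u u'" for u u' v
  proof -
    have "le (f u v) (f u' v)"
      using canonical_le(1)[OF same_type_lt[OF assms that] same_type_refl] True by blast
    then show ?thesis using lt_not_ge[OF that, of v v] by (auto simp: strict_def)
  qed
  then show ?thesis by blast
next
  case False
  then show ?thesis using lt_not_ge[OF assms, of y y] by (simp add: incomp_def)
qed

lemma eq_lt_cases:
  assumes "lt y y'"
  shows "(\<forall>u v v'. lt v v' \<longrightarrow> lt (f u v) (f u v')) \<or> inc (f x y) (f x y')"
proof (cases "le (f x y) (f x y')")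
  case True
  have "lt (f u v) (f u v')" if "lt v v'" for u v v'
  proof -
    have "le (f u v) (f u v')"
      using canonical_le(1)[OF same_type_refl same_type_lt[OF assms that]] True by blast
    then show ?thesis using eq_lt_not_ge[OF that, of u] by (auto simp: strict_def)
  qed
  then show ?thesis by blast
next
  case False
  then show ?thesis using eq_lt_not_ge[OF assms, of x] by (simp add: incomp_def)
qed

text \<open>\<open>T\<close> is the strict order that \<open>e\<close> induces on pairs of
  arguments. The assumption \<open>other\<close> is what the removal procedure needs: a
  comparability of \<open>f(r, s)\<close> outside \<open>T\<close> must be an incomparability of
  \<open>f(s, r)\<close>.\<close>

lemma preserves_product_embedding:
  fixes e :: "'a \<Rightarrow> 'a \<Rightarrow> 'a"
  assumes R: "fo_definable le n R" "preserves2 f R"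
    and e: "\<And>a b a' b'. le (e a b) (e a' b') \<longleftrightarrow> (a = a' \<and> b = b') \<or> T a b a' b'"
    and T: "\<And>a b a' b'. T a b a' b' \<Longrightarrow> lt (f a b) (f a' b') \<and> lt (f b a) (f b' a')"
    and other: "\<And>a b a' b'. lt (f a b) (f a' b') \<Longrightarrow> \<not> T a b a' b' \<Longrightarrow> inc (f b a) (f b' a')"
  shows "preserves2 e R"
  unfolding preserves2_def
proof (intro ballI impI)
  fix xs ys assume xs: "xs \<in> R" and ys: "ys \<in> R" and "length xs = length ys"
  have n: "length xs = n" "length ys = n" using R(1) xs ys by (auto simp: fo_definable_def)
  have map2: "map2 g us vs = map (\<lambda>i. g (us ! i) (vs ! i)) [0..<n]"
    if "length us = n" "length vs = n" for g :: "'a \<Rightarrow> 'a \<Rightarrow> 'a" and us vs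
    using that by (intro nth_equalityI) simp_all
  define z where "z i = f (xs ! i) (ys ! i)" for i
  define w where "w i = f (ys ! i) (xs ! i)" for i
  have "map2 f xs ys \<in> R" "map2 f ys xs \<in> R"
    using R(2) xs ys n by (simp_all add: preserves2_def)
  then have "map z [0..<n] \<in> R" "map w [0..<n] \<in> R"
    using n by (simp_all add: map2 z_def[abs_def] w_def[abs_def])
  then have "\<exists>z'. map z' [0..<n] \<in> R \<and> (\<forall>a<n. \<forall>b<n.
      (lt (z' a) (z' b) \<longleftrightarrow> T (xs ! a) (ys ! a) (xs ! b) (ys ! b)) \<and> (z' a = z' b \<longleftrightarrow> w a = w b))"
    by (intro remove_comparabilities[OF R, of z w])
      (auto simp: z_def w_def f_eq_iff dest: T intro: other)
  then obtain z' where z': "map z' [0..<n] \<in> R"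
    "\<And>a b. a < n \<Longrightarrow> b < n \<Longrightarrow> lt (z' a) (z' b) \<longleftrightarrow> T (xs ! a) (ys ! a) (xs ! b) (ys ! b)"
    "\<And>a b. a < n \<Longrightarrow> b < n \<Longrightarrow> z' a = z' b \<longleftrightarrow> xs ! a = xs ! b \<and> ys ! a = ys ! b"
    by (auto simp: w_def f_eq_iff)
  have "le (z' a) (z' b) \<longleftrightarrow> le (e (xs ! a) (ys ! a)) (e (xs ! b) (ys ! b))" if "a < n" "b < n" for a b
    using z'(2,3)[OF that] e by (metis le_refl strict_def)
  \<comment> \<open>The constructed tuple has the order type of the \<open>e\<close>-image, so
    membership in \<open>R\<close> carries over.\<close>
  from fo_definable_type_invariant[OF R(1) z'(1) this]
  show "map2 e xs ys \<in> R" by (simp add: map2 n)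
qed

lemma generates_e_lt_or_e_le:
  assumes "is_reduct le \<Gamma>" "binary_pol \<Gamma> f" "is_e_lt le e_lt" "is_e_le le e_le"
  shows "binary_pol \<Gamma> e_lt \<or> binary_pol \<Gamma> e_le"
proof (cases "(\<forall>u u' v. lt u u' \<longrightarrow> lt (f u v) (f u' v)) \<and> (\<forall>u v v'. lt v v' \<longrightarrow> lt (f u v) (f u v'))")
  case True
  \<comment> \<open>The strict part of the product order.\<close>
  define T where "T a b a' b' \<longleftrightarrow> le a a' \<and> le b b' \<and> \<not> (a = a' \<and> b = b')" for a b a' b'
  have "preserves2 e_le R" if "R \<in> \<Gamma>" for R
  proof -
    obtain n where n: "fo_definable le n R" using assms(1) \<open>R \<in> \<Gamma>\<close> by (auto simp: is_reduct_def)
    show ?thesis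
    proof (rule preserves_product_embedding[OF n, where T = T])
      show "preserves2 f R" using assms(2) \<open>R \<in> \<Gamma>\<close> by (simp add: binary_pol_def)
      show "le (e_le a b) (e_le a' b') \<longleftrightarrow> (a = a' \<and> b = b') \<or> T a b a' b'" for a b a' b'
        using assms(4) by (auto simp: is_e_le_def T_def)
      show "lt (f a b) (f a' b') \<and> lt (f b a) (f b' a')" if "T a b a' b'" for a b a' b'
        using that True lt_lt[of a a' b b'] lt_lt[of b b' a a'] unfolding T_def
        by (metis strict_def)
      \<comment> \<open>The essential case has \<open>b\<close> and \<open>b'\<close> incomparable:
        exchanging arguments puts them first, where \<open>inc_any\<close> applies. The other cases
        are contradictory or settled by \<open>lt_gt\<close>.\<close>
      show "inc (f b a) (f b' a')" if z: "lt (f a b) (f a' b')" and nT: "\<not> T a b a' b'" for a b a' b'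
      proof (cases a a' rule: trichotomy)
        case eq
        show ?thesis
        proof (cases b b' rule: trichotomy)
          case gt
          then show ?thesis using eq z eq_lt_not_ge[of b' b a] by (simp add: strict_def)
        qed (use eq z nT inc_any in \<open>auto simp: T_def strict_def\<close>)
      next
        case lt
        show ?thesis
        proof (cases b b' rule: trichotomy)
          case gt
          then show ?thesis using lt lt_gt inc_sym by blast
        qed (use lt nT inc_any in \<open>auto simp: T_def strict_def\<close>)
      next
        case gt
        then show ?thesis using z lt_not_ge[of a' a] by (simp add: strict_def)
      next
        case inc
        then show ?thesis using z inc_any[of a a'] by (simp add: strict_def incomp_def)
      qed
    qed
  qed
  then show ?thesis by (simp add: binary_pol_def)
next
  case False
  have "preserves2 e_lt R" if "R \<in> \<Gamma>" for R
  proof -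
    obtain n where n: "fo_definable le n R" using assms(1) \<open>R \<in> \<Gamma>\<close> by (auto simp: is_reduct_def)
    show ?thesis
    proof (rule preserves_product_embedding[OF n, where T = "\<lambda>a b a' b'. lt a a' \<and> lt b b'"])
      show "preserves2 f R" using assms(2) \<open>R \<in> \<Gamma>\<close> by (simp add: binary_pol_def)
      show "le (e_lt a b) (e_lt a' b') \<longleftrightarrow> (a = a' \<and> b = b') \<or> lt a a' \<and> lt b b'" for a b a' b'
      proof -
        have "e_lt a b = e_lt a' b' \<longleftrightarrow> a = a' \<and> b = b'"
          using assms(3) inj_eq[of "\<lambda>(a, b). e_lt a b" "(a, b)" "(a', b')"] by (simp add: is_e_lt_def)
        moreover have "lt (e_lt a b) (e_lt a' b') \<longleftrightarrow> lt a a' \<and> lt b b'"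
          using assms(3) by (simp add: is_e_lt_def)
        ultimately show ?thesis by (metis le_refl strict_def)
      qed
      show "lt (f a b) (f a' b') \<and> lt (f b a) (f b' a')" if "lt a a' \<and> lt b b'" for a b a' b'
        using that lt_lt by blast
      show "inc (f b a) (f b' a')" if z: "lt (f a b) (f a' b')" and nT: "\<not> (lt a a' \<and> lt b b')" for a b a' b'
      proof (cases a a' rule: trichotomy)
        case eq
        show ?thesis
        proof (cases b b' rule: trichotomy)
          case lt
          \<comment> \<open>Here \<open>f\<close> increases strictly in its second argument, hence
            by the case assumption not in its first; \<open>lt_eq_cases\<close> then makes the
            exchanged values incomparable. The case \<open>b = b'\<close> below is
            symmetric.\<close>
          have "\<not> inc (f a b) (f a b')" using z eq by (simp add: strict_def incomp_def)
          then show ?thesis using lt eq False eq_lt_cases[OF lt, of a] lt_eq_cases[OF lt, of a] by blast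
        next
          case gt
          then show ?thesis using eq z eq_lt_not_ge[of b' b a] by (simp add: strict_def)
        qed (use eq z inc_any in \<open>auto simp: strict_def\<close>)
      next
        case lt
        show ?thesis
        proof (cases b b' rule: trichotomy)
          case eq
          have "\<not> inc (f a b) (f a' b)" using z eq by (simp add: strict_def incomp_def)
          then show ?thesis using lt eq False eq_lt_cases[OF lt, of b] lt_eq_cases[OF lt, of b] by blast
        next
          case gt
          then show ?thesis using lt lt_gt inc_sym by blast
        qed (use lt nT inc_any in auto)
      next
        case gt
        then show ?thesis using z lt_not_ge[of a' a] by (simp add: strict_def)
      next
        case inc
        then show ?thesis using z inc_any[of a a'] by (simp add: strict_def incomp_def)
      qed
    qed
  qed
  then show ?thesis by (simp add: binary_pol_def)
qed

end

section \<open>Non-dominated canonical operations are reducing up to exchange\<close>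

context canonical_op
begin

lemma swapped: "canonical_op le pr (\<lambda>x y. f y x)"
  by (rule canonical_op.intro[OF random_ordered_poset_axioms canonical_op_axioms.intro[OF
        canonical2_swap[OF canonical] preserves2_swap[OF f_lt] preserves2_swap[OF f_inc]]])

text \<open>A comparability in one direction makes \<open>f\<close> dominated on the first argument;
  in the other direction it does so for the exchanged operation.\<close>

lemma lt_gt_inc:
  assumes "\<not> dominated le f" "lt x x'" "lt y' y"
  shows "inc (f x y) (f x' y')"
  using assms dominated_first_if_lt_gt[of x x' y' y]
    canonical_op.dominated_first_if_lt_gt[OF swapped, of y' y x x']
  by (auto simp: incomp_def dominated_def)

text \<open>Two steps of this type can compose to a step with \<open>x < x'\<close> and
  \<open>v2 < v0\<close>, through a point \<open>v1\<close> linearly between \<open>v2\<close> and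
  \<open>v0\<close> but incomparable to both. By transitivity a comparability in either direction
  would contradict \<open>lt_gt_inc\<close>.\<close>

lemma lt_inc_pr_inc:
  assumes nd: "\<not> dominated le f" and x: "lt x x'" and y: "inc_pr y' y"
  shows "inc (f x y) (f x' y')"
proof -
  obtain x'' where x'': "lt x x''" "lt x'' x'" using ex_between[OF x] by blast
  obtain v0 v2 where v: "lt v2 v0" using ex_lt_lt by blast
  obtain v1 where v1: "inc_pr v2 v1" "inc_pr v1 v0" using ex_inc_pr_between[OF v] by blast
  note c1 = canonical_le[OF same_type_lt[OF x x''(1)] same_type_inc_pr'[OF y v1(2)]]
  note c2 = canonical_le[OF same_type_lt[OF x x''(2)] same_type_inc_pr'[OF y v1(1)]]
  have "inc (f x v0) (f x' v2)" using lt_gt_inc[OF nd x v] .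
  then show ?thesis
    using c1 c2 le_trans[of "f x v0" "f x'' v1" "f x' v2"] le_trans[of "f x' v2" "f x'' v1" "f x v0"]
    by (auto simp: incomp_def)
qed

text \<open>The same composition, now with \<open>v0 < v2\<close>, turns two reversed comparisons
  into one that contradicts \<open>lt_lt\<close>.\<close>

lemma lt_inc_pr_not_ge:
  assumes x: "lt x x'" and y: "inc_pr y y'"
  shows "\<not> le (f x' y') (f x y)"
proof
  assume le: "le (f x' y') (f x y)"
  obtain x'' where x'': "lt x x''" "lt x'' x'" using ex_between[OF x] by blast
  obtain v0 v2 where v: "lt v0 v2" using ex_lt_lt by blast
  obtain v1 where v1: "inc_pr v0 v1" "inc_pr v1 v2" using ex_inc_pr_between[OF v] by blast
  have "le (f x'' v1) (f x v0)" "le (f x' v2) (f x'' v1)"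
    using canonical_le(2)[OF same_type_lt[OF x x''(1)] same_type_inc_pr[OF y v1(1)]]
      canonical_le(2)[OF same_type_lt[OF x x''(2)] same_type_inc_pr[OF y v1(2)]] le
    by blast+
  then have "le (f x' v2) (f x v0)" using le_trans by blast
  then show False using lt_not_le[OF lt_lt[OF x v]] by blast
qed

lemma lt_any_not_ge:
  assumes nd: "\<not> dominated le f" and x: "lt x x'"
  shows "\<not> le (f x' y') (f x y)"
proof (cases y y' rule: trichotomy)
  case eq
  \<comment> \<open>If \<open>f x' y \<le> f x y\<close>, then
    \<open>f x'' y'' < f x' y \<le> f x y\<close>, although \<open>x < x''\<close> and
    \<open>y'' < y\<close> make the outer values incomparable.\<close>
  obtain x'' where x'': "lt x x''" "lt x'' x'" using ex_between[OF x] by blast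
  obtain y'' where y'': "lt y'' y" using ex_gt_gt by blast
  have "lt (f x'' y'') (f x' y)" "inc (f x y) (f x'' y'')"
    using lt_lt[OF x''(2) y''] lt_gt_inc[OF nd x''(1) y''] .
  then show ?thesis
    using eq lt_le_trans[of "f x'' y''" "f x' y" "f x y"] by (auto simp: incomp_def strict_def)
next
  case lt
  then show ?thesis using lt_not_le[OF lt_lt[OF x lt]] by blast
next
  case gt
  then show ?thesis using lt_gt_inc[OF nd x gt] by (simp add: incomp_def)
next
  case inc
  then consider "inc_pr y y'" | "inc_pr y' y" using inc_pr_total inc_sym by blast
  then show ?thesis
    using lt_inc_pr_inc[OF nd x, of y' y] lt_inc_pr_not_ge[OF x, of y y'] by cases (auto simp: incomp_def)
qed

text \<open>Both comparabilities chain to \<open>f a y \<le> f a' d \<le> f x d'\<close>, where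
  \<open>a\<close>, \<open>x\<close> and \<open>y\<close>, \<open>d'\<close> are incomparable,
  against \<open>inc_inc\<close>. Hence \<open>f\<close> or its exchange satisfies the second
  hypothesis of the next lemma.\<close>

lemma not_lt_inc_pr_and_inc_pr_lt:
  assumes "lt a a'" "inc_pr b b'" "le (f a b) (f a' b')"
    and "inc_pr c c'" "lt d d'" "le (f c d) (f c' d')"
  shows False
proof -
  obtain x where x: "inc_pr a x" "inc_pr a' x" using ex_inc_pr_after by blast
  obtain y where y: "inc_pr y d" "inc_pr y d'" using ex_inc_pr_before by blast
  have "le (f a y) (f a' d)"
    using canonical_le(1)[OF same_type_lt[OF assms(1,1)] same_type_inc_pr[OF assms(2) y(1)]] assms(3)
    by blast
  moreover have "le (f a' d) (f x d')"
    using canonical_le(1)[OF same_type_inc_pr[OF assms(4) x(2)] same_type_lt[OF assms(5,5)]] assms(6)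
    by blast
  ultimately have "le (f a y) (f x d')" using le_trans by blast
  then show False using inc_inc[of a x y d'] x y by (simp add: incomp_def)
qed

lemma reducing_op_if_not_dominated:
  assumes nd: "\<not> dominated le f"
    and inc_pr_lt: "\<And>x x' y y'. inc_pr x x' \<Longrightarrow> lt y y' \<Longrightarrow> \<not> le (f x y) (f x' y')"
  shows "reducing_op le pr f"
proof -
  have nd': "\<not> dominated le (\<lambda>x y. f y x)" using nd by (simp add: dominated_def)
  have any_lt: "\<not> le (f x' y') (f x y)" if "lt y y'" for x x' y y'
    using canonical_op.lt_any_not_ge[OF swapped nd' that] .
  have inc_lt: "inc (f x y) (f x' y')" if x: "inc x x'" and y: "lt y y'" for x x' y y'
  proof (cases "pr x x'")
    case True
    then show ?thesis using inc_pr_lt[of x x' y y'] any_lt[OF y] x y by (simp add: incomp_def)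
  next
    case False
    then have "inc_pr x' x" using inc_pr_total[OF x] inc_sym[OF x] by blast
    then show ?thesis using canonical_op.lt_inc_pr_inc[OF swapped nd' y, of x' x] by blast
  qed
  have inc_eq: "\<not> le (f x y) (f x' y)" if x: "inc x x'" for x x' y
  proof
    assume le: "le (f x y) (f x' y)"
    \<comment> \<open>Moving strictly up from \<open>(x', y)\<close> to \<open>(x'', y'')\<close>
      while keeping \<open>x''\<close> incomparable to \<open>x\<close> contradicts
      \<open>inc_lt\<close>.\<close>
    obtain x'' where x'': "lt x' x''" "inc x x''" using ex_inc_above[OF x] by blast
    obtain y'' where y'': "lt y y''" using ex_lt_lt by blast
    have "lt (f x y) (f x'' y'')" using le_lt_trans[OF le lt_lt[OF x''(1) y'']] .
    then show False using inc_lt[OF x''(2) y''] by (simp add: incomp_def strict_def)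
  qed
  have eq_inc: "f x y \<noteq> f x y'" if y: "inc_pr y y'" for x y y'
  proof
    assume eq: "f x y = f x y'"
    \<comment> \<open>The common value lies below \<open>f x' z\<close> since \<open>y < z\<close>,
      yet is incomparable to it since \<open>z\<close> linearly precedes the incomparable
      \<open>y'\<close>.\<close>
    obtain z where z: "lt y z" "inc_pr z y'" using ex_lt_inc_pr[OF y] by blast
    obtain x' where x': "lt x x'" using ex_lt_lt by blast
    show False
      using lt_lt[OF x' z(1)] lt_inc_pr_inc[OF nd x' z(2)] eq by (simp add: incomp_def strict_def)
  qed
  show ?thesis
  proof (intro reducing_op.intro reducing_op_axioms.intro canonical_op_axioms)
    show "inc (f x y) (f x' y)" if "inc x x'" for x x' y
      using inc_eq[of x x' y] inc_eq[of x' x y] that by (simp add: incomp_def)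
    show "inc (f x y) (f x' y')" if "lt x x'" "inc y y'" "pr y' y" for x x' y y'
      using lt_inc_pr_inc[OF nd that(1)] that inc_sym by blast
    show "f x y \<noteq> f x y'" if "inc y y'" for x y y'
      using inc_pr_total[OF that] eq_inc[of y y' x] eq_inc[of y' y x] that inc_sym[OF that] by metis
  qed (use lt_gt_inc[OF nd] inc_lt lt_any_not_ge[OF nd] any_lt in blast)+
qed

end

theorem theorem36:
  fixes le pr :: "'a \<Rightarrow> 'a \<Rightarrow> bool"
    and \<Gamma> :: "'a list set set"
    and f e_lt e_le :: "'a \<Rightarrow> 'a \<Rightarrow> 'a"
  assumes "fraisse_limit_K le pr"
    and "is_reduct le \<Gamma>"
    and "pp_definable \<Gamma> 2 {[x, y] | x y. strict le x y}"
    and "pp_definable \<Gamma> 2 {[x, y] | x y. incomp le x y}"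
    and "binary_pol \<Gamma> f"
    and "canonical2 le pr f"
    and "is_e_lt le e_lt"
    and "is_e_le le e_le"
  shows "dominated le f \<or> binary_pol \<Gamma> e_lt \<or> binary_pol \<Gamma> e_le"
proof (cases "dominated le f")
  case False
  interpret canonical_op le pr f
    using assms(1,6) pp_definable_preserved[OF assms(3,5)] pp_definable_preserved[OF assms(4,5)]
    by unfold_locales
  have nd': "\<not> dominated le (\<lambda>x y. f y x)" using False by (simp add: dominated_def)
  show ?thesis
  \<comment> \<open>The split decides which of \<open>f\<close> and its exchange is reducing; both
    belong to the polymorphisms, so either generates the embedding.\<close>
  proof (cases "\<exists>x x' y y'. inc_pr x x' \<and> lt y y' \<and> le (f x y) (f x' y')")
    case False
    then have "reducing_op le pr f"
      using reducing_op_if_not_dominated[OF \<open>\<not> dominated le f\<close>] by blast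
    then show ?thesis
      using reducing_op.generates_e_lt_or_e_le assms(2,5,7,8) by blast
  next
    case True
    then have "\<not> le (f y x) (f y' x')" if "inc_pr x x'" "lt y y'" for x x' y y'
      using not_lt_inc_pr_and_inc_pr_lt that by blast
    then have "reducing_op le pr (\<lambda>x y. f y x)"
      using canonical_op.reducing_op_if_not_dominated[OF swapped nd'] by blast
    then show ?thesis
      using reducing_op.generates_e_lt_or_e_le binary_pol_swap assms(2,5,7,8) by blast
  qed
qed simp

end
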